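(* Let $d\ge 2$ and let $\{P_n\}_{n\ge0}$ and $\{Q_n\}_{n\ge0}$ be monic $d$-orthogonal polynomial sequences, where $Q_n=(n+1)^{-1}\mathcal{L}P_{n+1}$ for a lowering operator $\mathcal{L}$, connected by $$P_n(x)=Q_n(x)-\lambda_nQ_{n-1}(x),\qquad n\ge 0\quad (Q_{-1}=0),$$ with $\lambda_n\neq0$ for all $n\ge1$. Let $\beta_n,\gamma_n^{k}$ and $\xi_n,\eta_n^{k}$ be the recurrence coefficients of $\{P_n\}$ and $\{Q_n\}$ respectively, and let $c$ be the constant, independent of $n$, such that $$\beta_n=c-\lambda_n-\sum_{j=0}^{d-1}\frac{\eta_{n-j}^{d-1-j}}{\lambda_n\lambda_{n-1}\cdots\lambda_{n-j}},\qquad n\ge d .$$ Then, for all $n\ge d+1$, $$(x-c)Q_{n-1}(x)=P_n(x)+(\lambda_n+\xi_{n-1}-c)P_{n-1}(x)-\sum_{i=2}^{d}\sum_{j=i}^{d}\frac{\eta_{n-j}^{d-j}}{\lambda_{n-i}\lambda_{n-i-1}\cdots\lambda_{n-j}}\,P_{n-i}(x).$$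
   Context: Polynomials have complex coefficients. A lowering operator $\mathcal{L}$ is a linear operator on polynomials which decreases the degree by exactly one and satisfies $\mathcal{L}(1)=0$. A sequence of monic polynomials $\{P_n\}_{n\ge0}$ with $\deg P_n=n$ is a $d$-orthogonal polynomial sequence ($d$-OPS) if there are linear functionals $u_0,\dots,u_{d-1}$ on polynomials such that, for each $0\le r\le d-1$ and all $m\ge0$: $\langle u_r,x^mP_n\rangle=0$ for $n\ge md+r+1$, and $\langle u_r,x^mP_{md+r}\rangle\ne0$. Equivalently (a known analogue of Favard's theorem), $P_0=1$ and $$P_{n+1}(x)=(x-\beta_n)P_n(x)-\sum_{\nu=0}^{d-1}\gamma_{n-\nu}^{d-1-\nu}P_{n-1-\nu}(x),\qquad n\ge0,$$ with the convention $P_m=0$ for $m<0$, and with $\gamma_m^0\neq0$ for all $m\ge1$. The superscripts are indices, not powers. The recurrence coefficients of $\{Q_n\}$ are denoted analogously: $$Q_{n+1}(x)=(x-\xi_n)Q_n(x)-\sum_{\nu=0}^{d-1}\eta_{n-\nu}^{d-1-\nu}Q_{n-1-\nu}(x),\qquad n\ge0,\quad \eta_m^0\ne0\ (m\ge1).$$ Under the stated hypotheses it is known that the quantity $\beta_n+\lambda_n+\sum_{j=0}^{d-1}\eta_{n-j}^{d-1-j}/(\lambda_n\cdots\lambda_{n-j})$, $n\ge d$, does not depend on $n$; this common value is $c$. *)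

theory Defs
  imports Complex_Main "HOL-Computational_Algebra.Polynomial"
begin

(* The term with index n - k of a sequence of polynomials,
   under the convention that terms with negative index are 0. *)
definition shift_back :: "(nat \<Rightarrow> complex poly) \<Rightarrow> nat \<Rightarrow> nat \<Rightarrow> complex poly" where
  "shift_back P n k = (if k \<le> n then P (n - k) else 0)"

(* The conjunct L p \<noteq> 0 matters when degree p = 1, because degree 0 = 0. *)
definition lowering_operator :: "(complex poly \<Rightarrow> complex poly) \<Rightarrow> bool" where
  "lowering_operator L \<longleftrightarrow>
     Vector_Spaces.linear smult smult L \<and> L 1 = 0 \<and>
     (\<forall>p. degree p \<ge> 1 \<longrightarrow> L p \<noteq> 0 \<and> degree (L p) + 1 = degree p)"

definition monic_d_OPS :: "nat \<Rightarrow> (nat \<Rightarrow> complex poly) \<Rightarrow> bool" where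
  "monic_d_OPS d P \<longleftrightarrow>
     (\<forall>n. degree (P n) = n \<and> lead_coeff (P n) = 1) \<and>
     (\<exists>u :: nat \<Rightarrow> complex poly \<Rightarrow> complex.
        \<forall>r<d. Vector_Spaces.linear smult (*) (u r) \<and>
          (\<forall>m. (\<forall>n \<ge> m * d + r + 1. u r (monom 1 m * P n) = 0) \<and>
               u r (monom 1 m * P (m * d + r)) \<noteq> 0))"

(* b n is the coefficient written \<beta>\<^sub>n, and g k m is the coefficient with
   superscript k and subscript m. Values g k 0 only ever multiply
   terms of negative index, so they are unconstrained. *)
definition recurrence_coeffs ::
  "nat \<Rightarrow> (nat \<Rightarrow> complex poly) \<Rightarrow> (nat \<Rightarrow> complex) \<Rightarrow> (nat \<Rightarrow> nat \<Rightarrow> complex) \<Rightarrow> bool" where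
  "recurrence_coeffs d P b g \<longleftrightarrow>
     P 0 = 1 \<and>
     (\<forall>n. P (n + 1) = [:- b n, 1:] * P n
             - (\<Sum>\<nu><d. smult (g (d - 1 - \<nu>) (n - \<nu>)) (shift_back P n (\<nu> + 1)))) \<and>
     (\<forall>m\<ge>1. g 0 m \<noteq> 0)"

end

theory Submission imports Defs begin

text \<open>
  The idea is to expand \<open>(x - c) Q\<^sub>n\<^sub>-\<^sub>1\<close> by the recurrence of the \<open>Q\<^sub>n\<close> and to
  return from the \<open>Q\<^sub>n\<close> to the \<open>P\<^sub>n\<close> by inverting the two-term connection.
  Dividing \<open>P\<^sub>k = Q\<^sub>k - \<lambda>\<^sub>k Q\<^sub>k\<^sub>-\<^sub>1\<close> by a product of consecutive \<open>\<lambda>\<close>'s turns it into a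
  telescoping difference (\<open>connection_telescope\<close>), so that each low-index term \<open>Q\<^sub>n\<^sub>-\<^sub>1\<^sub>-\<^sub>j\<close>
  becomes a combination of \<open>P\<^sub>n\<^sub>-\<^sub>2, \<dots>, P\<^sub>n\<^sub>-\<^sub>j\<close> plus a multiple of \<open>Q\<^sub>n\<^sub>-\<^sub>2\<close>.
  Those combinations make up the double sum of the claim, and what is left is a multiple of
  \<open>Q\<^sub>n\<^sub>-\<^sub>2\<close>. Its coefficient is
  \<open>\<lambda>\<^sub>n\<^sub>-\<^sub>1\<close> times \<open>\<lambda>\<^sub>n + \<xi>\<^sub>n\<^sub>-\<^sub>1 - c + \<Sum>\<^sub>j e\<^sub>j / (\<lambda>\<^sub>n\<^sub>-\<^sub>1 \<cdots> \<lambda>\<^sub>n\<^sub>-\<^sub>j)\<close>, where \<open>e\<^sub>j\<close> is the coefficient of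
  \<open>Q\<^sub>n\<^sub>-\<^sub>1\<^sub>-\<^sub>j\<close> in the expansion and, by the definition of \<open>c\<close>, the sum equals \<open>c - \<lambda>\<^sub>n\<^sub>-\<^sub>1 - \<beta>\<^sub>n\<^sub>-\<^sub>1\<close>. It vanishes because
  \<open>\<lambda>\<^sub>n + \<xi>\<^sub>n\<^sub>-\<^sub>1 = \<lambda>\<^sub>n\<^sub>-\<^sub>1 + \<beta>\<^sub>n\<^sub>-\<^sub>1\<close>, which is the comparison of subleading coefficients in the connection
  (\<open>connection_coeff_step\<close>).
\<close>

text \<open>
  Only the product \<open>(x - b\<^sub>k) P\<^sub>k\<close> in the recurrence for \<open>P\<^sub>k\<^sub>+\<^sub>1\<close> reaches the two highest powers: every
  term of the sum is a multiple of some \<open>P\<^sub>m\<close> with \<open>m < k\<close>. Taking \<open>k = n + 1\<close> keeps the index of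
  the subleading coefficient of \<open>P\<^sub>k\<close> nonnegative.
\<close>

lemma recurrence_subleading_coeff:
  assumes rec: "recurrence_coeffs d P b g"
    and deg: "\<And>n. degree (P n) = n" and monic: "\<And>n. lead_coeff (P n) = 1"
  shows "coeff (P (Suc (Suc n))) (Suc n) = coeff (P (Suc n)) n - b (Suc n)"
proof -
  have low: "coeff (shift_back P (Suc n) (\<nu> + 1)) (Suc n) = 0" for \<nu>
    by (auto simp: shift_back_def deg intro!: coeff_eq_0)
  have "P (Suc (Suc n)) = [:- b (Suc n), 1:] * P (Suc n)
          - (\<Sum>\<nu><d. smult (g (d - 1 - \<nu>) (Suc n - \<nu>)) (shift_back P (Suc n) (\<nu> + 1)))"
    using rec unfolding recurrence_coeffs_def by (metis Suc_eq_plus1)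
  moreover have "coeff (P (Suc n)) (Suc n) = 1"
    using monic[of "Suc n"] deg[of "Suc n"] by simp
  ultimately show ?thesis
    using low by (simp add: coeff_sum mult_pCons_left)
qed

text \<open>
  By the previous lemma, subtracting the connection at \<open>n + 1\<close> from the one at \<open>n + 2\<close> in their
  subleading coefficients leaves only the increment of \<open>\<lambda>\<close> and the difference of the coefficients
  \<open>\<beta>\<close> and \<open>\<xi>\<close>.
\<close>

lemma connection_coeff_step:
  assumes P: "recurrence_coeffs d P \<beta> \<gamma>" "\<And>n. degree (P n) = n" "\<And>n. lead_coeff (P n) = 1"
    and Q: "recurrence_coeffs d Q \<xi> \<eta>" "\<And>n. degree (Q n) = n" "\<And>n. lead_coeff (Q n) = 1"
    and conn: "\<And>n. P (Suc n) = Q (Suc n) - smult (lam (Suc n)) (Q n)"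
  shows "lam (Suc (Suc n)) + \<xi> (Suc n) = lam (Suc n) + \<beta> (Suc n)"
proof -
  have sub: "coeff (P (Suc k)) k = coeff (Q (Suc k)) k - lam (Suc k)" for k
    using Q(3)[of k] Q(2)[of k] by (simp add: conn)
  show ?thesis
    using sub[of n] sub[of "Suc n"] recurrence_subleading_coeff[OF P, of n]
      recurrence_subleading_coeff[OF Q, of n] by algebra
qed

text \<open>
  Division by \<open>\<lambda>\<^sub>n\<^sub>-\<^sub>i \<cdots> \<lambda>\<^sub>n\<^sub>-\<^sub>j\<close> makes the \<open>i\<close>-th term a difference \<open>f i - f (i + 1)\<close>;
  at \<open>i = j + 1\<close> the product is empty, whence the unweighted \<open>Q\<close> at the end.
\<close>

lemma connection_telescope:
  fixes P Q :: "nat \<Rightarrow> complex poly"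
  assumes conn: "\<And>n. P (Suc n) = Q (Suc n) - smult (lam (Suc n)) (Q n)"
    and nz: "\<And>n. n \<ge> 1 \<Longrightarrow> lam n \<noteq> 0"
    and "m \<le> Suc j" "j < n"
  shows "(\<Sum>i=m..j. smult (1 / (\<Prod>k=i..j. lam (n - k))) (P (n - i)))
       = smult (1 / (\<Prod>k=m..j. lam (n - k))) (Q (n - m)) - Q (n - Suc j)"
proof -
  define f where "f i = - smult (1 / (\<Prod>k=i..j. lam (n - k))) (Q (n - i))" for i
  have "smult (1 / (\<Prod>k=i..j. lam (n - k))) (P (n - i)) = f (Suc i) - f i"
    if i: "i \<in> {m..j}" for i
  proof -
    obtain l where l: "n - i = Suc l" "n - Suc i = l"
      using i \<open>j < n\<close> less_imp_Suc_add[of i n] by auto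
    have "(\<Prod>k=i..j. lam (n - k)) = lam (n - i) * (\<Prod>k=Suc i..j. lam (n - k))"
      using i by (simp add: prod.atLeast_Suc_atMost)
    then show ?thesis
      using nz[of "Suc l"] by (simp add: f_def l conn smult_diff_right)
  qed
  then have "(\<Sum>i=m..j. smult (1 / (\<Prod>k=i..j. lam (n - k))) (P (n - i)))
           = (\<Sum>i=m..j. f (Suc i) - f i)"
    by (intro sum.cong) auto
  also have "\<dots> = f (Suc j) - f m"
    using \<open>m \<le> Suc j\<close> by (rule sum_Suc_diff)
  finally show ?thesis
    by (simp add: f_def)
qed

theorem proposition3p1:
  fixes d :: nat
    and P Q :: "nat \<Rightarrow> complex poly"
    and L :: "complex poly \<Rightarrow> complex poly"
    and lam \<beta> \<xi> :: "nat \<Rightarrow> complex"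
    and \<gamma> \<eta> :: "nat \<Rightarrow> nat \<Rightarrow> complex"
    and c :: complex
  assumes "d \<ge> 2"
    and "monic_d_OPS d P" and "monic_d_OPS d Q"
    and "lowering_operator L"
    and "\<And>n. Q n = smult (1 / of_nat (n + 1)) (L (P (n + 1)))"
    and "\<And>n. P n = Q n - smult (lam n) (shift_back Q n 1)"
    and "\<And>n. n \<ge> 1 \<Longrightarrow> lam n \<noteq> 0"
    and "recurrence_coeffs d P \<beta> \<gamma>" and "recurrence_coeffs d Q \<xi> \<eta>"
    and "\<And>n. n \<ge> d \<Longrightarrow>
           \<beta> n = c - lam n - (\<Sum>j=0..d-1. \<eta> (d - 1 - j) (n - j) / (\<Prod>k=0..j. lam (n - k)))"
  shows "\<forall>n \<ge> d + 1.
           [:- c, 1:] * Q (n - 1) =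
             P n + smult (lam n + \<xi> (n - 1) - c) (P (n - 1))
             - (\<Sum>i=2..d. \<Sum>j=i..d.
                  smult (\<eta> (d - j) (n - j) / (\<Prod>k=i..j. lam (n - k))) (P (n - i)))"
  proof (intro allI impI)
  fix n assume "n \<ge> d + 1"
  define e where "e j = \<eta> (d - j) (n - j)" for j
  define w where "w i j = (\<Prod>k=i..j. lam (n - k))" for i j
  have degP: "degree (P k) = k" "lead_coeff (P k) = 1"
    and degQ: "degree (Q k) = k" "lead_coeff (Q k) = 1" for k
    using assms(2,3) unfolding monic_d_OPS_def by blast+
  have conn: "P (Suc k) = Q (Suc k) - smult (lam (Suc k)) (Q k)" for k
    by (subst assms(6)) (simp add: shift_back_def)
  obtain N where N: "n = Suc (Suc N)"
    using \<open>n \<ge> d + 1\<close> \<open>d \<ge> 2\<close> by (metis add_2_eq_Suc le_add_diff_inverse le_trans trans_le_add1)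

  have lam_n1: "lam (Suc N) \<noteq> 0"
    by (rule assms(7)) simp
  have w1: "w 1 j = lam (Suc N) * w 2 j" if "j \<ge> 1" for j
    using that by (simp add: w_def N prod.atLeast_Suc_atMost numeral_2_eq_2)

  \<comment> \<open>The defining property of \<open>c\<close> is applied at \<open>n - 1\<close>, so its index \<open>j\<close> is the present \<open>j - 1\<close>.\<close>
  have c_sum: "(\<Sum>j=1..d. e j / w 1 j) = c - lam (Suc N) - \<beta> (Suc N)"
  proof -
    have "(\<Sum>j=1..d. e j / w 1 j)
        = (\<Sum>j=0..d-1. \<eta> (d - 1 - j) (Suc N - j) / (\<Prod>k=0..j. lam (Suc N - k)))"
    proof (rule sum.reindex_bij_witness[where i = Suc and j = "\<lambda>j. j - 1"])
      fix j assume "j \<in> {1..d}"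
      then obtain i where "j = Suc i" by (cases j) auto
      then show "\<eta> (d - 1 - (j - 1)) (Suc N - (j - 1)) / (\<Prod>k=0..j-1. lam (Suc N - k))
                 = e j / w 1 j"
        using prod.shift_bounds_cl_Suc_ivl[of "\<lambda>k. lam (n - k)" 0 i]
        by (simp add: e_def w_def N)
    qed (use \<open>d \<ge> 2\<close> in auto)
    then show ?thesis
      using assms(10)[of "Suc N"] \<open>n \<ge> d + 1\<close> N by simp
  qed
  have Q_coeff: "(\<Sum>j=1..d. e j / w 2 j) = - lam (Suc N) * (lam n + \<xi> (Suc N) - c)"
  proof -
    have "(\<Sum>j=1..d. e j / w 2 j) = lam (Suc N) * (\<Sum>j=1..d. e j / w 1 j)"
      unfolding sum_distrib_left using lam_n1 by (intro sum.cong) (auto simp: w1[simplified])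
    also have "\<dots> = lam (Suc N) * (c - (lam (Suc N) + \<beta> (Suc N)))"
      unfolding c_sum by (simp add: algebra_simps)
    also have "lam (Suc N) + \<beta> (Suc N) = lam n + \<xi> (Suc N)"
      using connection_coeff_step[OF assms(8) degP assms(9) degQ conn, of N] N by simp
    finally show ?thesis by (simp add: algebra_simps)
  qed

  have Q_rec: "[:- c, 1:] * Q (Suc N)
      = Q n + smult (\<xi> (Suc N) - c) (Q (Suc N)) + (\<Sum>j=1..d. smult (e j) (Q (n - Suc j)))"
  proof -
    have "Q n = [:- \<xi> (Suc N), 1:] * Q (Suc N)
        - (\<Sum>\<nu><d. smult (\<eta> (d - 1 - \<nu>) (Suc N - \<nu>)) (shift_back Q (Suc N) (\<nu> + 1)))"
      using assms(9) N unfolding recurrence_coeffs_def by (metis Suc_eq_plus1)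
    also have "(\<Sum>\<nu><d. smult (\<eta> (d - 1 - \<nu>) (Suc N - \<nu>)) (shift_back Q (Suc N) (\<nu> + 1)))
        = (\<Sum>j=1..d. smult (e j) (Q (n - Suc j)))"
      by (rule sum.reindex_bij_witness[where i = "\<lambda>j. j - 1" and j = Suc])
        (use \<open>n \<ge> d + 1\<close> in \<open>auto simp: e_def shift_back_def N\<close>)
    finally show ?thesis
      by (simp add: algebra_simps smult_diff_left)
  qed

  \<comment> \<open>Exchanging the sums makes the inner one telescope. The term \<open>j = 1\<close> contributes \<open>0\<close>, since
    its inner sum is empty; including it matches the range of the recurrence.\<close>
  have "(\<Sum>i=2..d. \<Sum>j=i..d. smult (e j / w i j) (P (n - i)))
      = (\<Sum>j=1..d. \<Sum>i=2..j. smult (e j / w i j) (P (n - i)))"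
  proof -
    have "(\<Sum>i=2..d. \<Sum>j=i..d. smult (e j / w i j) (P (n - i)))
        = (\<Sum>i=2..d. \<Sum>j | j \<in> {1..d} \<and> i \<le> j. smult (e j / w i j) (P (n - i)))"
      by (intro sum.cong) auto
    also have "\<dots> = (\<Sum>j=1..d. \<Sum>i | i \<in> {2..d} \<and> i \<le> j. smult (e j / w i j) (P (n - i)))"
      by (rule sum.swap_restrict) auto
    also have "\<dots> = (\<Sum>j=1..d. \<Sum>i=2..j. smult (e j / w i j) (P (n - i)))"
      by (intro sum.cong) auto
    finally show ?thesis .
  qed
  also have "\<dots> = (\<Sum>j=1..d. smult (e j / w 2 j) (Q N) - smult (e j) (Q (n - Suc j)))"
  proof (rule sum.cong[OF refl])
    fix j assume "j \<in> {1..d}"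
    have "(\<Sum>i=2..j. smult (e j / w i j) (P (n - i)))
        = smult (e j) (\<Sum>i=2..j. smult (1 / w i j) (P (n - i)))"
      by (rule poly_eqI) (simp add: coeff_sum sum_distrib_left)
    also have "\<dots> = smult (e j) (smult (1 / w 2 j) (Q (n - 2)) - Q (n - Suc j))"
      unfolding w_def using \<open>j \<in> {1..d}\<close> \<open>n \<ge> d + 1\<close>
      by (subst connection_telescope[where lam = lam and Q = Q, OF conn assms(7)]) auto
    finally show "(\<Sum>i=2..j. smult (e j / w i j) (P (n - i)))
        = smult (e j / w 2 j) (Q N) - smult (e j) (Q (n - Suc j))"
      by (simp add: N smult_diff_right)
  qed
  also have "\<dots> = smult (\<Sum>j=1..d. e j / w 2 j) (Q N) - (\<Sum>j=1..d. smult (e j) (Q (n - Suc j)))"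
    by (simp add: sum_subtractf smult_sum)
  finally have P_sum: "(\<Sum>i=2..d. \<Sum>j=i..d. smult (e j / w i j) (P (n - i)))
      = - smult (lam (Suc N) * (lam n + \<xi> (Suc N) - c)) (Q N)
        - (\<Sum>j=1..d. smult (e j) (Q (n - Suc j)))"
    unfolding Q_coeff by simp

  have "[:- c, 1:] * Q (Suc N) = P n + smult (lam n + \<xi> (Suc N) - c) (P (Suc N))
      - (\<Sum>i=2..d. \<Sum>j=i..d. smult (e j / w i j) (P (n - i)))"
    unfolding P_sum Q_rec conn[of N]
    using conn[of "Suc N"]
    by (simp add: N smult_diff_right smult_diff_left smult_add_left algebra_simps)
  then show "[:- c, 1:] * Q (n - 1) = P n + smult (lam n + \<xi> (n - 1) - c) (P (n - 1))
      - (\<Sum>i=2..d. \<Sum>j=i..d.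
           smult (\<eta> (d - j) (n - j) / (\<Prod>k=i..j. lam (n - k))) (P (n - i)))"
    by (simp add: e_def w_def N)
qed

end
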